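(* For every integer $k \geq 1$, $$\ell(k) \;\geq\; \left\lfloor \frac{\sqrt{1+2k^2}-1}{2} \right\rfloor \left( \left\lfloor \frac{\sqrt{1+2k^2}-1}{2} \right\rfloor + 1 \right) \;>\; \frac{k^2}{2} - \sqrt{2}\,k .$$
   Context: A finite word is an abelian square of order $r$ if it is of the form $xx'$ with $|x| = |x'| = r$ and $x'$ a permutation (rearrangement of the letters) of $x$. A word contains an abelian square if some contiguous block (factor) of it is an abelian square. For an integer $k \geq 1$, $\ell(k)$ denotes the length of the longest word over $\{0,1\}$ containing no abelian square of order $\geq k$. (It is a known theorem of Entringer, Jackson and Schatz that every binary word of length $k^2+6k$ contains an abelian square of order $k$ or greater, so $\ell(k)$ is a well-defined finite number.) *)

theory Defs
  imports Complex_Main "HOL-Library.Multiset" "HOL-Library.Sublist"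
begin

definition abelian_square :: "nat \<Rightarrow> 'a list \<Rightarrow> bool" where
  "abelian_square r u \<longleftrightarrow>
     (\<exists>x x'. u = x @ x' \<and> length x = r \<and> length x' = r \<and> mset x' = mset x)"

definition contains_abelian_square_ge :: "nat \<Rightarrow> 'a list \<Rightarrow> bool" where
  "contains_abelian_square_ge k w \<longleftrightarrow> (\<exists>r\<ge>k. \<exists>u. sublist u w \<and> abelian_square r u)"

(* Max is meaningful only for a finite nonempty set. For k \<ge> 1 the set below contains 0
   (the empty word) and, by the theorem of Entringer, Jackson and Schatz, is bounded. *)
definition ell :: "nat \<Rightarrow> nat" where
  "ell k = Max {length w | w. w \<in> lists {0, 1 :: nat} \<and> \<not> contains_abelian_square_ge k w}"

end

theory Submission
  imports Defs
begin

text \<open>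
  Let \<open>S m\<close> be the number of ones among the first \<open>m\<close> letters of a binary word. A factor of length
  \<open>2 * r\<close> starting at position \<open>i\<close> is an abelian square exactly when the second difference
  \<open>S i + S (i + 2 * r) - 2 * S (i + r)\<close> vanishes (\<open>contains_abelian_square_ge_iff\<close>).

  For the lower bound, let \<open>S\<close> follow a parabola: \<open>S i = \<lfloor>i\<^sup>2 / (2 * L)\<rfloor>\<close>. The second
  difference of \<open>i\<^sup>2 / (2 * L)\<close> with step \<open>r\<close> is \<open>r\<^sup>2 / L\<close>, and rounding down loses strictly less
  than 2, so nothing vanishes once \<open>r\<^sup>2 \<ge> 2 * L\<close>. The slope of the parabola stays below 1 up to
  \<open>i = L\<close>, which makes \<open>S\<close> the counting function of a binary word of length \<open>L\<close>. Any \<open>L\<close> with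
  \<open>2 * L \<le> k\<^sup>2\<close> is therefore the length of a word without abelian squares of order at least
  \<open>k\<close> (\<open>ell_ge\<close>), and for
  \<open>n = \<lfloor>(sqrt (1 + 2 * k\<^sup>2) - 1) / 2\<rfloor>\<close>, the largest integer with \<open>2 * n * (n + 1) \<le> k\<^sup>2\<close>,
  one such length is \<open>n * (n + 1)\<close>.

  The maximum of an infinite set of naturals is an unspecified value, so the lower bound also needs the
  Entringer--Jackson--Schatz theorem, that binary words of length \<open>k\<^sup>2 + 6 * k\<close> contain abelian
  squares of order at least \<open>k\<close> (\<open>second_difference_vanishes\<close>). The second difference with step
  \<open>k\<close> cannot keep one sign for long, since otherwise the number of ones in consecutive blocks of
  length \<open>k\<close> would be strictly monotone. If it never vanishes it must jump between \<open>1\<close> and \<open>-1\<close> when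
  the position moves by one. Such a jump propagates to every larger step around the same centre
  (\<open>sign_jump_propagates\<close>), and it forces the letters to the left of it to be constant; \<open>2 * k\<close>
  equal letters in a row are an abelian square of order \<open>k\<close>.
\<close>

section \<open>Abelian squares as vanishing second differences\<close>

definition ones :: "nat list \<Rightarrow> nat \<Rightarrow> int" where
  "ones w m = int (count (mset (take m w)) 1)"

lemma ones_add: "ones w (i + r) = ones w i + int (count (mset (take r (drop i w))) 1)"
  by (simp add: ones_def take_add)

lemma ones_Suc:
  assumes "set w \<subseteq> {0, 1}" "m < length w"
  shows "ones w (Suc m) = ones w m \<or> ones w (Suc m) = ones w m + 1"
  using assms by (auto simp: ones_def take_Suc_conv_app_nth)

lemma binary_mset_eq_iff:
  fixes x y :: "nat list"
  assumes "set x \<subseteq> {0, 1}" "set y \<subseteq> {0, 1}" "length x = length y"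
  shows "mset x = mset y \<longleftrightarrow> count (mset x) 1 = count (mset y) 1"
proof
  have "mset z = replicate_mset (length z - count (mset z) 1) 0
      + replicate_mset (count (mset z) 1) 1" if "set z \<subseteq> {0, 1}" for z :: "nat list"
    using that
  proof (induction z)
    case (Cons a z)
    have "count (mset z) 1 \<le> length z"
      by (metis count_le_length count_mset)
    with Cons show ?case by (auto simp: Suc_diff_le)
  qed simp
  then show "mset x = mset y" if "count (mset x) 1 = count (mset y) 1"
    using assms that by metis
qed simp

lemma contains_abelian_square_ge_iff:
  assumes "set w \<subseteq> {0, 1}"
  shows "contains_abelian_square_ge k w \<longleftrightarrow>
    (\<exists>r\<ge>k. \<exists>i. i + 2 * r \<le> length w \<and> ones w i + ones w (i + 2 * r) - 2 * ones w (i + r) = 0)"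
    (is "_ \<longleftrightarrow> ?vanishes")
proof -
  have twice: "i + 2 * r = i + r + r" for i r :: nat by simp
  show ?thesis
  proof
    assume "contains_abelian_square_ge k w"
    then obtain r p x x' s where r: "r \<ge> k" and w: "w = p @ (x @ x') @ s"
      and len: "length x = r" "length x' = r" and eq: "mset x' = mset x"
      unfolding contains_abelian_square_ge_def abelian_square_def sublist_def by blast
    have "ones w (length p + r) = ones w (length p) + int (count (mset x) 1)"
      using len by (simp add: ones_add w)
    moreover have "ones w (length p + r + r) = ones w (length p + r) + int (count (mset x') 1)"
      using len by (simp only: ones_add[of w "length p + r"]) (simp add: w)
    ultimately have "ones w (length p) + ones w (length p + 2 * r) - 2 * ones w (length p + r) = 0"
      unfolding twice using eq by simp
    moreover have "length p + 2 * r \<le> length w"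
      using len by (simp add: w)
    ultimately show ?vanishes
      using r by blast
  next
    assume ?vanishes
    then obtain r i where r: "r \<ge> k" and i: "i + 2 * r \<le> length w"
      and zero: "ones w i + ones w (i + 2 * r) - 2 * ones w (i + r) = 0" by blast
    define x x' where "x = take r (drop i w)" and "x' = take r (drop (i + r) w)"
    have len: "length x = r" "length x' = r"
      using i by (auto simp: x_def x'_def)
    have "set x \<subseteq> set w" "set x' \<subseteq> set w"
      by (auto simp: x_def x'_def dest: in_set_takeD in_set_dropD)
    moreover have "count (mset x') 1 = count (mset x) 1"
      using zero[unfolded twice] ones_add[of w i r] ones_add[of w "i + r" r]
      unfolding x_def x'_def by linarith
    ultimately have "mset x' = mset x"
      using binary_mset_eq_iff[of x' x] assms len by auto
    moreover have "x @ x' = take (2 * r) (drop i w)"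
      unfolding mult_2 x_def x'_def by (simp only: take_add drop_drop add.commute)
    then have "sublist (x @ x') w"
      using sublist_order.order.trans[OF sublist_take sublist_drop] by simp
    ultimately show "contains_abelian_square_ge k w"
      unfolding contains_abelian_square_ge_def abelian_square_def using r len by blast
  qed
qed

section \<open>Long words contain abelian squares\<close>

text \<open>
  When the position moves by one, the second difference changes by
  \<open>a i + a (i + 2 * r) - 2 * a (i + r)\<close>, with \<open>a\<close> the letters. So a jump from \<open>1\<close> to \<open>-1\<close> means that
  \<open>a i\<close> and \<open>a (i + 2 * r)\<close> are \<open>0\<close> and \<open>a (i + r)\<close> is \<open>1\<close>. Widening both halves by one
  letter to step \<open>r + 1\<close>, at position \<open>i - 1\<close> or \<open>i\<close>, then changes the values \<open>1\<close> and \<open>-1\<close>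
  by at most one towards zero, and if zero is avoided they are unchanged: the jump recurs one position
  further left.
\<close>

lemma sign_jump_propagates:
  fixes S :: "nat \<Rightarrow> int"
  assumes step: "\<And>m. m < L \<Longrightarrow> S (Suc m) = S m \<or> S (Suc m) = S m + 1"
    and nonzero: "\<And>r i. r \<ge> k \<Longrightarrow> i + 2 * r \<le> L \<Longrightarrow> S i + S (i + 2 * r) - 2 * S (i + r) \<noteq> 0"
    and jump: "S (i + j) + S (i + j + 2 * k) - 2 * S (i + j + k) = 1"
      "S (Suc (i + j)) + S (Suc (i + j + 2 * k)) - 2 * S (Suc (i + j + k)) = -1"
    and bound: "i + 2 * j + 2 * k + 1 \<le> L"
  shows "S i + S (i + 2 * (k + j)) - 2 * S (i + (k + j)) = 1
    \<and> S (Suc i) + S (Suc (i + 2 * (k + j))) - 2 * S (Suc (i + (k + j))) = -1"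
  using jump bound
proof (induction j arbitrary: i)
  case 0
  then show ?case by simp
next
  case (Suc j)
  define c e where "c = Suc i + (k + j)" and "e = Suc i + 2 * (k + j)"
  have IH: "S (Suc i) + S e - 2 * S c = 1" "S (Suc (Suc i)) + S (Suc e) - 2 * S (Suc c) = -1"
    using Suc.IH[of "Suc i"] Suc.prems by (simp_all add: c_def e_def)
  have le: "Suc (Suc e) \<le> L" "c \<le> e"
    using Suc.prems by (auto simp: c_def e_def)
  then have st: "S (Suc n) = S n \<or> S (Suc n) = S n + 1" if "n \<in> {i, Suc i, c, e, Suc e}" for n
    using step[of n] that by (auto simp: c_def e_def)
  have "S i + S (i + 2 * (k + Suc j)) - 2 * S (i + (k + Suc j)) \<noteq> 0"
    "S (Suc i) + S (Suc i + 2 * (k + Suc j)) - 2 * S (Suc i + (k + Suc j)) \<noteq> 0"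
    using le(1) by (intro nonzero; simp add: e_def)+
  moreover have idx: "i + 2 * (k + Suc j) = Suc e" "i + (k + Suc j) = c"
    "Suc i + 2 * (k + Suc j) = Suc (Suc e)" "Suc i + (k + Suc j) = Suc c"
    by (auto simp: c_def e_def)
  ultimately have nz: "S i + S (Suc e) - 2 * S c \<noteq> 0"
    "S (Suc i) + S (Suc (Suc e)) - 2 * S (Suc c) \<noteq> 0"
    by simp_all
  have "S i + S (Suc e) - 2 * S c = 1 \<and> S (Suc i) + S (Suc (Suc e)) - 2 * S (Suc c) = -1"
    using IH nz st[of i] st[of "Suc i"] st[of c] st[of e] st[of "Suc e"] by simp linarith
  then show ?case by (simp only: idx(1,2))
qed

text \<open>
  The factors compared stay at distance \<open>2 * k\<close> from both ends of the word, which leaves room to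
  propagate a jump over \<open>2 * k\<close> positions; \<open>k\<^sup>2\<close> positions in between are enough to
  find one.
\<close>

lemma second_difference_vanishes_if_pos:
  fixes S :: "nat \<Rightarrow> int"
  assumes step: "\<And>m. m < L \<Longrightarrow> S (Suc m) = S m \<or> S (Suc m) = S m + 1"
    and long: "k\<^sup>2 + 6 * k \<le> L"
    and pos: "S (2 * k) + S (2 * k + 2 * k) - 2 * S (2 * k + k) > 0"
  shows "\<exists>r\<ge>k. \<exists>i. i + 2 * r \<le> L \<and> S i + S (i + 2 * r) - 2 * S (i + r) = 0"
proof (rule ccontr)
  assume contra: "\<not> ?thesis"
  define D where "D i = S i + S (i + 2 * k) - 2 * S (i + k)" for i
  have nonzero: "S i + S (i + 2 * r) - 2 * S (i + r) \<noteq> 0" if "r \<ge> k" "i + 2 * r \<le> L" for r i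
    using contra that by blast
  have block: "S (i + n) \<ge> S i \<and> S (i + n) \<le> S i + int n" if "i + n \<le> L" for i n
    using that
  proof (induction n)
    case (Suc n)
    then show ?case using step[of "i + n"] by auto
  qed simp
  have "\<exists>m\<le>k * k. \<not> D (2 * k + m) > 0"
  proof (rule ccontr)
    assume "\<not> ?thesis"
    then have Dpos: "D (2 * k + m) > 0" if "m \<le> k * k" for m
      using that by blast
    \<comment> \<open>Each block of length \<open>k\<close> has more ones than the one before it, so the last of \<open>k + 2\<close>
      blocks would need \<open>k + 1\<close> ones.\<close>
    have "S (2 * k + m * k + k) - S (2 * k + m * k) \<ge> int m" if "m \<le> Suc k" for m
      using that
    proof (induction m)
      case 0
      have "2 * k + k \<le> L" using long by simp
      then show ?case using block[of "2 * k" k] by simp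
    next
      case (Suc m)
      then have "D (2 * k + m * k) > 0" using Dpos[of "m * k"] by simp
      with Suc show ?case by (simp add: D_def algebra_simps)
    qed
    from this[of "Suc k"] have "S (2 * k + Suc k * k + k) - S (2 * k + Suc k * k) > int k"
      by simp
    moreover have "2 * k + Suc k * k + k \<le> L"
      using long by (simp add: power2_eq_square)
    ultimately show False using block[of "2 * k + Suc k * k" k] by simp
  qed
  then obtain m0 where m0: "m0 \<le> k * k" "\<not> D (2 * k + m0) > 0"
    by blast
  define m where "m = (LEAST m. \<not> D (2 * k + m) > 0)"
  have m: "m \<le> k * k" "\<not> D (2 * k + m) > 0"
    unfolding m_def
    using Least_le[of "\<lambda>m. \<not> D (2 * k + m) > 0", OF m0(2)] m0(1)
      LeastI[of "\<lambda>m. \<not> D (2 * k + m) > 0", OF m0(2)] by linarith+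
  have least: "D (2 * k + m') > 0" if "m' < m" for m'
    using not_less_Least[OF that[unfolded m_def]] by blast
  have "m \<noteq> 0"
  proof
    assume "m = 0"
    then show False using m(2) pos by (simp add: D_def)
  qed
  then obtain n where n: "m = Suc n" using not0_implies_Suc by blast
  define i where "i = n + 2 * k"
  have i: "i + 4 * k + 1 \<le> L"
    using m(1) n long by (simp add: i_def power2_eq_square)
  have "D i > 0"
    using least[of n] n by (simp add: i_def add.commute)
  moreover have "D (Suc i) < 0"
    using m(2) n nonzero[of k "Suc i"] i by (simp add: i_def D_def add.commute)
  ultimately have jump: "D i = 1" "D (Suc i) = -1"
    using step[of i] step[of "i + k"] step[of "i + 2 * k"] i unfolding D_def
    by (simp; linarith)+
  have const: "S (Suc p) = S p" if p: "i = p + j" and "j \<le> 2 * k" for p j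
  proof -
    have le: "p + 2 * (k + j) < L" using i that by simp
    have "S p + S (p + 2 * (k + j)) - 2 * S (p + (k + j)) = 1
      \<and> S (Suc p) + S (Suc (p + 2 * (k + j))) - 2 * S (Suc (p + (k + j))) = -1"
    proof (rule sign_jump_propagates[OF step nonzero])
      show "p + 2 * j + 2 * k + 1 \<le> L" using le by simp
    qed (use jump in \<open>simp_all add: D_def p\<close>)
    then show ?thesis
      using step[of p] step[of "p + (k + j)"] step[OF le] le by simp linarith
  qed
  have flat: "S (n + q) = S n" if "q \<le> 2 * k" for q
    using that
  proof (induction q)
    case (Suc q)
    then show ?case using const[of "n + q" "2 * k - q"] by (simp add: i_def)
  qed simp
  show False
    using flat[of k] flat[of "2 * k"] nonzero[of k n] i by (simp add: i_def)
qed

text \<open>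
  Exchanging the two letters replaces \<open>S m\<close> by \<open>m - S m\<close> and negates all second differences, which
  removes the assumption on the sign.
\<close>

lemma second_difference_vanishes:
  fixes S :: "nat \<Rightarrow> int"
  assumes step: "\<And>m. m < L \<Longrightarrow> S (Suc m) = S m \<or> S (Suc m) = S m + 1"
    and long: "k\<^sup>2 + 6 * k \<le> L"
  shows "\<exists>r\<ge>k. \<exists>i. i + 2 * r \<le> L \<and> S i + S (i + 2 * r) - 2 * S (i + r) = 0"
proof -
  define T where "T m = int m - S m" for m
  have T: "T i + T (i + 2 * r) - 2 * T (i + r) = - (S i + S (i + 2 * r) - 2 * S (i + r))" for i r
    by (simp add: T_def)
  have T_step: "T (Suc m) = T m \<or> T (Suc m) = T m + 1" if "m < L" for m
    using step[OF that] by (auto simp: T_def)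
  consider "S (2 * k) + S (2 * k + 2 * k) - 2 * S (2 * k + k) > 0"
    | "S (2 * k) + S (2 * k + 2 * k) - 2 * S (2 * k + k) = 0"
    | "T (2 * k) + T (2 * k + 2 * k) - 2 * T (2 * k + k) > 0"
    unfolding T by linarith
  then show ?thesis
  proof cases
    case 1
    with step long show ?thesis by (rule second_difference_vanishes_if_pos)
  next
    case 2
    then show ?thesis using long by (intro exI[of _ k] conjI exI[of _ "2 * k"]) auto
  next
    case 3
    with T_step long have
      "\<exists>r\<ge>k. \<exists>i. i + 2 * r \<le> L \<and> T i + T (i + 2 * r) - 2 * T (i + r) = 0"
      by (rule second_difference_vanishes_if_pos)
    then show ?thesis by (simp only: T neg_equal_0_iff_equal)
  qed
qed

lemma length_le_ell:
  fixes w :: "nat list"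
  assumes "w \<in> lists {0, 1}" "\<not> contains_abelian_square_ge k w"
  shows "length w \<le> ell k"
proof -
  have "length v < k\<^sup>2 + 6 * k"
    if "v \<in> lists {0, 1}" "\<not> contains_abelian_square_ge k v" for v :: "nat list"
  proof (rule ccontr)
    assume "\<not> ?thesis"
    moreover have v: "set v \<subseteq> {0, 1}" using that(1) by auto
    ultimately show False
      using second_difference_vanishes[of "length v" "ones v" k] ones_Suc[OF v] that(2)
      by (simp add: contains_abelian_square_ge_iff[OF v])
  qed
  then have "{length w | w. w \<in> lists {0, 1 :: nat} \<and> \<not> contains_abelian_square_ge k w}
      \<subseteq> {..<k\<^sup>2 + 6 * k}"
    by blast
  then have "finite {length w | w. w \<in> lists {0, 1 :: nat} \<and> \<not> contains_abelian_square_ge k w}"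
    by (rule finite_subset) simp
  moreover have "length w \<in> {length w | w. w \<in> lists {0, 1 :: nat} \<and> \<not> contains_abelian_square_ge k w}"
    unfolding mem_Collect_eq by (intro exI[of _ w] conjI refl assms)
  ultimately show ?thesis
    unfolding ell_def by (rule Max_ge)
qed

section \<open>The parabola word\<close>

lemma parabola_step:
  fixes L m :: nat
  assumes "m < L"
  shows "(Suc m)\<^sup>2 div (2 * L) = m\<^sup>2 div (2 * L) \<or> (Suc m)\<^sup>2 div (2 * L) = Suc (m\<^sup>2 div (2 * L))"
proof -
  have "(Suc m)\<^sup>2 = m\<^sup>2 + (2 * m + 1)" by (simp add: power2_eq_square)
  then have "m\<^sup>2 \<le> (Suc m)\<^sup>2" "(Suc m)\<^sup>2 \<le> m\<^sup>2 + 2 * L" using assms by simp_all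
  then have "m\<^sup>2 div (2 * L) \<le> (Suc m)\<^sup>2 div (2 * L)"
    "(Suc m)\<^sup>2 div (2 * L) \<le> (m\<^sup>2 + 2 * L) div (2 * L)"
    by (simp_all only: div_le_mono)
  moreover have "(m\<^sup>2 + 2 * L) div (2 * L) = Suc (m\<^sup>2 div (2 * L))"
    using assms by simp
  ultimately show ?thesis by linarith
qed

lemma parabola_second_difference:
  fixes L i r :: nat
  assumes "L > 0" "2 * L \<le> r\<^sup>2"
  shows "2 * ((i + r)\<^sup>2 div (2 * L)) < i\<^sup>2 div (2 * L) + (i + 2 * r)\<^sup>2 div (2 * L)"
proof -
  define M where "M = 2 * L"
  have M: "M > 0" "M \<le> r\<^sup>2" using assms by (simp_all add: M_def)
  have "M * (2 * ((i + r)\<^sup>2 div M)) \<le> 2 * (i + r)\<^sup>2"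
    by (simp add: mult.left_commute)
  moreover have "i\<^sup>2 < M * (i\<^sup>2 div M) + M" "(i + 2 * r)\<^sup>2 < M * ((i + 2 * r)\<^sup>2 div M) + M"
    using M(1) by (simp_all add: dividend_less_times_div add.commute)
  moreover have "i\<^sup>2 + (i + 2 * r)\<^sup>2 = 2 * (i + r)\<^sup>2 + 2 * r\<^sup>2"
    by (simp add: power2_eq_square algebra_simps)
  ultimately have "M * (2 * ((i + r)\<^sup>2 div M)) < M * (i\<^sup>2 div M) + M * ((i + 2 * r)\<^sup>2 div M)"
    using M(2) by linarith
  then show ?thesis
    unfolding M_def[symmetric] by (simp flip: distrib_left)
qed

lemma ell_ge:
  assumes "2 * L \<le> k\<^sup>2"
  shows "L \<le> ell k"
proof (cases "L = 0")
  case False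
  define S where "S i = i\<^sup>2 div (2 * L)" for i :: nat
  define w where "w = map (\<lambda>i. S (Suc i) - S i) [0..<L]"
  have step: "S (Suc m) = S m \<or> S (Suc m) = Suc (S m)" if "m < L" for m
    using parabola_step[OF that] by (simp add: S_def)
  have w: "set w \<subseteq> {0, 1}"
    using step by (fastforce simp: w_def)
  have len: "length w = L" by (simp add: w_def)
  have ones_w: "ones w m = int (S m)" if "m \<le> L" for m
    using that
  proof (induction m)
    case 0
    then show ?case by (simp add: ones_def S_def)
  next
    case (Suc m)
    then have "ones w (Suc m) = ones w m + (if w ! m = 1 then 1 else 0)"
      using len by (simp add: ones_def take_Suc_conv_app_nth)
    with Suc show ?case using step[of m] by (auto simp: w_def)
  qed
  have "ones w i + ones w (i + 2 * r) - 2 * ones w (i + r) \<noteq> 0"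
    if "r \<ge> k" "i + 2 * r \<le> length w" for r i
  proof -
    have "2 * L \<le> r\<^sup>2"
      using assms that(1) by (meson le_trans power_mono zero_le)
    then have "2 * S (i + r) < S i + S (i + 2 * r)"
      unfolding S_def using False by (intro parabola_second_difference) auto
    then show ?thesis using that(2) len by (simp add: ones_w)
  qed
  then have "\<not> contains_abelian_square_ge k w"
    using contains_abelian_square_ge_iff[OF w] by blast
  then show ?thesis using length_le_ell[of w k] w len by (simp add: lists_eq_set)
qed simp

section \<open>The explicit bound\<close>

theorem corollary2:
  fixes k :: nat
  assumes "k \<ge> 1"
  shows "int (ell k) \<ge> \<lfloor>(sqrt (1 + 2 * (real k)\<^sup>2) - 1) / 2\<rfloor> * (\<lfloor>(sqrt (1 + 2 * (real k)\<^sup>2) - 1) / 2\<rfloor> + 1)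
    \<and> real_of_int (\<lfloor>(sqrt (1 + 2 * (real k)\<^sup>2) - 1) / 2\<rfloor> * (\<lfloor>(sqrt (1 + 2 * (real k)\<^sup>2) - 1) / 2\<rfloor> + 1))
        > (real k)\<^sup>2 / 2 - sqrt 2 * real k"
proof -
  define s where "s = sqrt (1 + 2 * (real k)\<^sup>2)"
  define x where "x = (s - 1) / 2"
  define n where "n = \<lfloor>x\<rfloor>"
  have s2: "s\<^sup>2 = 1 + 2 * (real k)\<^sup>2" by (simp add: s_def)
  have "s > 1" using assms by (simp add: s_def)
  then have x: "x > 0" by (simp add: x_def)
  have n: "real_of_int n \<le> x" "x - 1 < real_of_int n" "n \<ge> 0"
    using x by (simp_all add: n_def)
  have "real_of_int n * (real_of_int n + 1) \<le> x * (x + 1)"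
    using n x by (intro mult_mono) auto
  also have "\<dots> = (real k)\<^sup>2 / 2"
    using s2 by (simp add: x_def field_simps power2_eq_square)
  finally have "real_of_int (2 * (n * (n + 1))) \<le> real_of_int ((int k)\<^sup>2)" by simp
  then have "2 * (n * (n + 1)) \<le> (int k)\<^sup>2" by linarith
  then have "int (2 * nat (n * (n + 1))) \<le> int (k\<^sup>2)" using n(3) by simp
  then have "2 * nat (n * (n + 1)) \<le> k\<^sup>2" by linarith
  then have lower: "n * (n + 1) \<le> int (ell k)"
    using ell_ge nat_le_iff by blast
  have "s \<le> 1 + sqrt 2 * real k"
    using sqrt_add_le_add_sqrt[of 1 "2 * (real k)\<^sup>2"] by (simp add: s_def real_sqrt_mult)
  moreover have "(x - 1) * x = (real k)\<^sup>2 / 2 + 1 - s"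
    using s2 by (simp add: x_def field_simps power2_eq_square)
  moreover have "(x - 1) * x < real_of_int n * (real_of_int n + 1)"
  \<comment> \<open>For \<open>x < 1\<close> the factor \<open>x - 1\<close> is negative, so the products cannot be compared factor by
    factor.\<close>
  proof (cases "x < 1")
    case True
    then have "(x - 1) * x < 0" using x by (simp add: mult_neg_pos)
    also have "0 \<le> real_of_int n * (real_of_int n + 1)" using n(3) by simp
    finally show ?thesis .
  next
    case False
    then show ?thesis using n(2) by (intro mult_strict_mono) auto
  qed
  ultimately have "(real k)\<^sup>2 / 2 - sqrt 2 * real k < real_of_int (n * (n + 1))"
    by simp
  with lower show ?thesis by (simp only: n_def x_def s_def)
qed

end
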